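(* Let $d\ge2$ be an integer, $0\le\eta\le1$, and let $$\rho=\eta\,|\psi_d\rangle\langle\psi_d|+(1-\eta)\,\frac{\mathbb{I}}{d}\otimes\frac{\mathbb{I}}{d},\qquad |\psi_d\rangle=\frac{1}{\sqrt d}\sum_{i=0}^{d-1}|ii\rangle,$$ be the isotropic state on $\mathbb{C}^d\otimes\mathbb{C}^d$. If $\rho$ admits a local hidden state model for projective measurements, i.e. if $$\eta\le\frac{H_d-1}{d-1},\qquad H_d=1+\frac12+\frac13+\dots+\frac1d,$$ then its conditional Rényi 2-entropy is non-negative: $S_2(A|B)_\rho\ge0$.
   Context: The first tensor factor is system $A$ and the second is system $B$. The condition $\eta\le\frac{H_d-1}{d-1}$ is the known condition (Wiseman, Jones, Doherty, 2007) under which the isotropic state admits a local hidden state (LHS) model for projective measurements; it is to be taken as the hypothesis of the claim. Rényi 2-entropy: $S_2(\rho)=-\log\mathrm{Tr}(\rho^2)$ (logarithm to base 2). Conditional Rényi 2-entropy: $S_2(A|B)_\rho=S_2(\rho)-S_2(\rho_B)$, where $\rho_B=\mathrm{Tr}_A\rho$. *)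

theory Defs
  imports "HOL-Analysis.Analysis"
begin

text \<open>
  A system with \<open>d\<close>-dimensional state space is modelled by \<open>complex ^ 'n\<close> with \<open>d = CARD('n)\<close>; the
  elements of \<open>'n\<close> label the computational basis. The tensor product of the spaces indexed by
  \<open>'a\<close> and \<open>'b\<close> is the space indexed by \<open>'a \<times> 'b\<close>, with system A as the first component.
\<close>

definition tensor_vec :: "complex ^ 'a \<Rightarrow> complex ^ 'b \<Rightarrow> complex ^ ('a \<times> 'b)" where
  "tensor_vec u v = (\<chi> p. u $ fst p * v $ snd p)"

definition tensor_mat ::
  "complex ^ 'a ^ 'a \<Rightarrow> complex ^ 'b ^ 'b \<Rightarrow> complex ^ ('a \<times> 'b) ^ ('a \<times> 'b)" where
  "tensor_mat A B = (\<chi> p q. A $ fst p $ fst q * B $ snd p $ snd q)"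

definition ket_bra :: "complex ^ 'a \<Rightarrow> complex ^ 'a \<Rightarrow> complex ^ 'a ^ 'a" where
  "ket_bra u v = (\<chi> i j. u $ i * cnj (v $ j))"

definition partial_trace_A ::
  "complex ^ ('a::finite \<times> 'b::finite) ^ ('a \<times> 'b) \<Rightarrow> complex ^ 'b ^ 'b" where
  "partial_trace_A \<rho> = (\<chi> j l. \<Sum>i\<in>UNIV. \<rho> $ (i, j) $ (i, l))"

definition max_entangled :: "complex ^ ('n::finite \<times> 'n)" where
  "max_entangled =
     (1 / sqrt (real CARD('n))) *\<^sub>R (\<Sum>i\<in>UNIV. tensor_vec (axis i 1) (axis i 1))"

definition maximally_mixed :: "complex ^ 'n::finite ^ 'n" where
  "maximally_mixed = (1 / real CARD('n)) *\<^sub>R mat 1"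

definition isotropic_state :: "real \<Rightarrow> complex ^ ('n::finite \<times> 'n) ^ ('n \<times> 'n)" where
  "isotropic_state \<eta> = \<eta> *\<^sub>R ket_bra max_entangled max_entangled
     + (1 - \<eta>) *\<^sub>R tensor_mat maximally_mixed maximally_mixed"

text \<open>For a Hermitian matrix the trace of the square is real, so \<open>Re\<close> only changes the type.\<close>

definition renyi2 :: "complex ^ 'a::finite ^ 'a \<Rightarrow> real" where
  "renyi2 \<rho> = - log 2 (Re (trace (\<rho> ** \<rho>)))"

definition cond_renyi2 :: "complex ^ ('a::finite \<times> 'b::finite) ^ ('a \<times> 'b) \<Rightarrow> real" where
  "cond_renyi2 \<rho> = renyi2 \<rho> - renyi2 (partial_trace_A \<rho>)"

end

theory Submission imports Defs begin

text \<open>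
  The isotropic state is \<open>\<eta> P + ((1 - \<eta>) / d\<^sup>2) I\<close> with \<open>P\<close> a rank-one projection, so its purity is
  \<open>\<eta>\<^sup>2 + (1 - \<eta>\<^sup>2) / d\<^sup>2\<close>, and the claim amounts to \<open>\<eta>\<^sup>2 \<le> 1 / (d + 1)\<close>. By Cauchy-Schwarz,
  \<open>(H\<^sub>d - 1)\<^sup>2 \<le> (d - 1) (1/2\<^sup>2 + \<dots> + 1/d\<^sup>2)\<close>, and the sum of inverse squares is at most
  \<open>(d - 1) / (d + 1)\<close> by telescoping.
\<close>

lemma sum_inverse_squares_le:
  assumes "n \<ge> 1"
  shows "(\<Sum>k\<in>{2..n}. (1 / real k)\<^sup>2) \<le> (real n - 1) / (real n + 1)"
  using assms
proof (induction n rule: dec_induct)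
  case base
  then show ?case by simp
next
  case (step n)
  \<comment> \<open>The right side equals \<open>2 / ((n + 1) * (n + 2))\<close>, and
    \<open>n + 2 \<le> 2 * (n + 1)\<close>.\<close>
  have "(1 / real (Suc n))\<^sup>2 \<le> real n / (real n + 2) - (real n - 1) / (real n + 1)"
    by (simp add: divide_simps power2_eq_square) (simp add: algebra_simps)
  with step show ?case
    by (simp add: algebra_simps)
qed

text \<open>Cauchy-Schwarz against the constant 1 on the \<open>n - 1\<close> indices from 2 to
  \<open>n\<close>; subtracting 1 removes the term \<open>k = 1\<close>. Clearing the denominator
  leaves \<open>(n - 1)\<^sup>2\<close> on the right, which later cancels against the hypothesis on
  \<open>\<eta>\<close>.\<close>

lemma harm_minus_one_squared_le:
  assumes "n \<ge> 1"
  shows "(harm n - 1 :: real)\<^sup>2 * (real n + 1) \<le> (real n - 1)\<^sup>2"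
proof -
  have "{1..n} = insert 1 {2..n}"
    using assms by auto
  then have "harm n - 1 = (\<Sum>k\<in>{2..n}. 1 / real k)"
    by (simp add: harm_def inverse_eq_divide)
  then have "(harm n - 1 :: real)\<^sup>2 \<le> (\<Sum>k\<in>{2..n}. (1 / real k)\<^sup>2) * (real n - 1)"
    using sum_squared_le_sum_of_squares[of "\<lambda>k. 1 / real k" "{2..n}"] assms
    by (simp add: of_nat_diff mult.commute)
  also have "\<dots> \<le> (real n - 1) / (real n + 1) * (real n - 1)"
    using assms by (intro mult_right_mono sum_inverse_squares_le) auto
  finally show ?thesis
    by (simp add: divide_simps power2_eq_square)
qed

lemma ket_bra_idempotent:
  fixes u :: "complex ^ 'a::finite"
  assumes "(\<Sum>i\<in>UNIV. cnj (u $ i) * u $ i) = 1"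
  shows "ket_bra u u ** ket_bra u u = ket_bra u u"
proof -
  have "(\<Sum>k\<in>UNIV. (u $ i * cnj (u $ k)) * (u $ k * cnj (u $ j))) = u $ i * cnj (u $ j)" for i j
  proof -
    have "(\<Sum>k\<in>UNIV. (u $ i * cnj (u $ k)) * (u $ k * cnj (u $ j)))
        = u $ i * cnj (u $ j) * (\<Sum>k\<in>UNIV. cnj (u $ k) * u $ k)"
      by (simp add: sum_distrib_left mult_ac)
    then show ?thesis using assms by simp
  qed
  then show ?thesis
    by (simp add: vec_eq_iff ket_bra_def matrix_matrix_mult_def)
qed

text \<open>The sum has the shape assumed in \<open>ket_bra_idempotent\<close>, so one normalisation
  fact gives both properties of the projection.\<close>

lemma trace_ket_bra:
  fixes u :: "complex ^ 'a::finite"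
  shows "trace (ket_bra u u) = (\<Sum>i\<in>UNIV. cnj (u $ i) * u $ i)"
  by (simp add: trace_def ket_bra_def mult.commute)

lemma trace_scaleR: "trace (c *\<^sub>R A) = c *\<^sub>R trace (A :: complex ^ 'a ^ 'a::finite)"
  by (simp add: trace_def scaleR_sum_right)

lemma matrix_add_rdistrib:
  fixes A B :: "'a::semiring_1 ^ 'm::finite ^ 'n"
  shows "(A + B) ** C = A ** C + B ** C"
  by (simp add: vec_eq_iff matrix_matrix_mult_def sum.distrib distrib_right)

text \<open>Idempotence collapses the square to
  \<open>(a\<^sup>2 + 2 * a * b) P + b\<^sup>2 I\<close>; the last summand contributes the dimension
  to the trace.\<close>

lemma trace_square_projection_plus_identity:
  fixes P :: "complex ^ 'a ^ 'a::finite"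
  assumes "P ** P = P" and "trace P = 1"
  shows "trace ((a *\<^sub>R P + b *\<^sub>R mat 1) ** (a *\<^sub>R P + b *\<^sub>R mat 1))
    = of_real (a\<^sup>2 + 2 * a * b + b\<^sup>2 * real CARD('a))"
proof -
  have "(a *\<^sub>R P + b *\<^sub>R mat 1) ** (a *\<^sub>R P + b *\<^sub>R mat 1)
      = (a\<^sup>2 + 2 * a * b) *\<^sub>R P + b\<^sup>2 *\<^sub>R (mat 1 :: complex ^ 'a ^ 'a)"
    using assms(1)
    by (simp add: matrix_add_ldistrib matrix_add_rdistrib matrix_scalar_ac
        flip: scalar_matrix_assoc)
      (simp add: vec_eq_iff scaleR_conv_of_real[where 'a = complex] algebra_simps power2_eq_square)
  then show ?thesis
    by (simp add: trace_add trace_scaleR trace_I assms(2)) (simp add: scaleR_conv_of_real)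
qed

lemma max_entangled_nth:
  "(max_entangled :: complex ^ ('n::finite \<times> 'n)) $ p
    = (if fst p = snd p then of_real (1 / sqrt (real CARD('n))) else 0)"
proof -
  \<comment> \<open>With the test on \<open>i\<close> outermost, the sum over \<open>i\<close>
    reduces to the term \<open>i = fst p\<close>.\<close>
  have "(tensor_vec (axis i 1) (axis i 1) :: complex ^ ('n \<times> 'n)) $ p
      = (if i = fst p then if fst p = snd p then 1 else 0 else 0)" for i
    by (auto simp: tensor_vec_def axis_def)
  then show ?thesis
    by (simp add: max_entangled_def scaleR_conv_of_real[where 'a = complex])
qed

lemma sum_diagonal:
  fixes c :: "'b::comm_monoid_add"
  shows "(\<Sum>p\<in>(UNIV :: ('n::finite \<times> 'n) set). if fst p = snd p then c else 0)
    = (\<Sum>i\<in>(UNIV :: 'n set). c)"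
proof -
  have "(\<Sum>p\<in>(UNIV :: ('n \<times> 'n) set). if fst p = snd p then c else 0)
      = (\<Sum>(i, j)\<in>(UNIV :: 'n set) \<times> (UNIV :: 'n set). if i = j then c else 0)"
    by (simp add: case_prod_beta)
  also have "\<dots> = (\<Sum>i\<in>(UNIV :: 'n set). \<Sum>j\<in>(UNIV :: 'n set). if i = j then c else 0)"
    by (simp only: sum.cartesian_product)
  finally show ?thesis
    by simp
qed

lemma max_entangled_unit:
  "(\<Sum>p\<in>UNIV. cnj ((max_entangled :: complex ^ ('n::finite \<times> 'n)) $ p) * max_entangled $ p) = 1"
proof -
  have "(\<Sum>p\<in>UNIV. cnj ((max_entangled :: complex ^ ('n \<times> 'n)) $ p) * max_entangled $ p)
      = (\<Sum>p\<in>(UNIV :: ('n \<times> 'n) set). if fst p = snd p then of_real (1 / real CARD('n)) else 0)"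
    by (intro sum.cong) (auto simp: max_entangled_nth simp flip: of_real_mult)
  then show ?thesis
    by (simp only: sum_diagonal) simp
qed

lemma tensor_maximally_mixed:
  "tensor_mat maximally_mixed maximally_mixed
    = (1 / (real CARD('n))\<^sup>2) *\<^sub>R (mat 1 :: complex ^ ('n::finite \<times> 'n) ^ ('n \<times> 'n))"
  by (auto simp: vec_eq_iff tensor_mat_def maximally_mixed_def mat_def power2_eq_square
      scaleR_conv_of_real[where 'a = complex])

lemma purity_isotropic:
  "trace (isotropic_state \<eta> ** (isotropic_state \<eta> :: complex ^ ('n::finite \<times> 'n) ^ ('n \<times> 'n)))
    = of_real (\<eta>\<^sup>2 + (1 - \<eta>\<^sup>2) / (real CARD('n))\<^sup>2)"
proof -
  define d where "d = real CARD('n)"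
  have d: "d > 0" by (simp add: d_def)
  have iso: "(isotropic_state \<eta> :: complex ^ ('n \<times> 'n) ^ ('n \<times> 'n))
      = \<eta> *\<^sub>R ket_bra max_entangled max_entangled + ((1 - \<eta>) / d\<^sup>2) *\<^sub>R mat 1"
    by (simp add: isotropic_state_def tensor_maximally_mixed d_def)
  \<comment> \<open>The case \<open>a = \<eta>\<close>, \<open>b = (1 - \<eta>) / d\<^sup>2\<close>
    in dimension \<open>d * d\<close>; the last two terms combine through \<open>(1 - \<eta>) * (2 *
    \<eta> + 1 - \<eta>) = 1 - \<eta>\<^sup>2\<close>.\<close>
  have "\<eta>\<^sup>2 + 2 * \<eta> * ((1 - \<eta>) / d\<^sup>2) + ((1 - \<eta>) / d\<^sup>2)\<^sup>2 * (d * d)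
      = \<eta>\<^sup>2 + (1 - \<eta>\<^sup>2) / d\<^sup>2"
    using d by (simp add: field_simps power2_eq_square)
  moreover have "real CARD('n \<times> 'n) = d * d"
    by (simp add: d_def)
  ultimately show ?thesis
    unfolding iso
      trace_square_projection_plus_identity[OF ket_bra_idempotent[OF max_entangled_unit]
        trace_ket_bra[of max_entangled, unfolded max_entangled_unit]]
    by (simp only: d_def)
qed

text \<open>Both the maximally entangled and the maximally mixed state reduce to the maximally mixed
  state on B, so the weight \<open>\<eta>\<close> drops out.\<close>

lemma partial_trace_isotropic:
  "partial_trace_A (isotropic_state \<eta> :: complex ^ ('n::finite \<times> 'n) ^ ('n \<times> 'n))
    = (1 / real CARD('n)) *\<^sub>R mat 1"
proof -
  define d where "d = real CARD('n)"
  have d: "d > 0" by (simp add: d_def)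
  have entry: "(isotropic_state \<eta> :: complex ^ ('n \<times> 'n) ^ ('n \<times> 'n)) $ (i, j) $ (i, l)
      = (if j = l then (if i = j then of_real (\<eta> / d) else 0) + of_real ((1 - \<eta>) / d\<^sup>2) else 0)"
    for i j l
    using d
    by (auto simp: isotropic_state_def tensor_maximally_mixed ket_bra_def max_entangled_nth mat_def
        scaleR_conv_of_real[where 'a = complex] simp flip: d_def of_real_mult)
  \<comment> \<open>A diagonal entry of the reduced state: the entangled part contributes only at
    \<open>i = j\<close>, the mixed part at all \<open>d\<close> values of \<open>i\<close>.\<close>
  have "complex_of_real (\<eta> / d) + of_real d * of_real ((1 - \<eta>) / d\<^sup>2) = of_real (1 / d)"
    using d by (simp add: field_simps power2_eq_square flip: of_real_mult of_real_add)
  then show ?thesis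
    by (auto simp: vec_eq_iff partial_trace_A_def entry mat_def sum.distrib
        scaleR_conv_of_real[where 'a = complex] d_def)
qed

lemma purity_partial_trace_isotropic:
  "trace (partial_trace_A (isotropic_state \<eta>)
      ** partial_trace_A (isotropic_state \<eta> :: complex ^ ('n::finite \<times> 'n) ^ ('n \<times> 'n)))
    = of_real (1 / real CARD('n))"
  unfolding partial_trace_isotropic
  by (simp add: matrix_scalar_ac trace_scaleR trace_I flip: scalar_matrix_assoc)
    (simp add: scaleR_conv_of_real)

theorem mainTheorem7:
  fixes \<eta> :: real
  assumes "CARD('n::finite) \<ge> 2"
    and "0 \<le> \<eta>" and "\<eta> \<le> 1"
    and "\<eta> \<le> (harm CARD('n) - 1) / (real CARD('n) - 1)"
  shows "cond_renyi2 (isotropic_state \<eta> :: complex ^ ('n \<times> 'n) ^ ('n \<times> 'n)) \<ge> 0"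
proof -
  define d where "d = real CARD('n)"
  have d: "d \<ge> 2" using assms(1) by (simp add: d_def)
  have "\<eta> * (d - 1) \<le> harm CARD('n) - 1"
    using assms(4) d by (simp add: d_def field_simps)
  \<comment> \<open>Squaring preserves the inequality because \<open>\<eta> * (d - 1)\<close> is
    nonnegative.\<close>
  then have "(\<eta> * (d - 1))\<^sup>2 * (d + 1) \<le> (harm CARD('n) - 1)\<^sup>2 * (d + 1)"
    using assms(2) d by (intro mult_right_mono power_mono) auto
  also have "\<dots> \<le> (d - 1)\<^sup>2"
    using harm_minus_one_squared_le[of "CARD('n)"] assms(1) by (simp add: d_def)
  finally have "(\<eta>\<^sup>2 * (d + 1)) * (d - 1)\<^sup>2 \<le> 1 * (d - 1)\<^sup>2"
    by (simp add: power_mult_distrib mult_ac)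
  then have "\<eta>\<^sup>2 * (d + 1) \<le> 1"
    using d by (subst (asm) mult_le_cancel_right) auto
  \<comment> \<open>This is \<open>\<eta>\<^sup>2 * (d\<^sup>2 - 1) + 1 \<le> d\<close>; dividing by
    \<open>d\<^sup>2\<close> compares the purity of the state with the purity \<open>1 / d\<close>
    of its reduction.\<close>
  then have "\<eta>\<^sup>2 * (d + 1) * (d - 1) \<le> 1 * (d - 1)"
    using d by (intro mult_right_mono) auto
  then have "(\<eta>\<^sup>2 * (d + 1) * (d - 1) + 1) / d\<^sup>2 \<le> d / d\<^sup>2"
    by (intro divide_right_mono) auto
  moreover have "(\<eta>\<^sup>2 * (d + 1) * (d - 1) + 1) / d\<^sup>2 = \<eta>\<^sup>2 + (1 - \<eta>\<^sup>2) / d\<^sup>2"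
    using d by (simp add: field_simps power2_eq_square)
  moreover have "d / d\<^sup>2 = 1 / d"
    by (simp add: power2_eq_square)
  ultimately have le: "\<eta>\<^sup>2 + (1 - \<eta>\<^sup>2) / d\<^sup>2 \<le> 1 / d"
    by simp
  have "\<eta>\<^sup>2 \<le> 1"
    using assms(2,3) by (simp add: power_le_one)
  \<comment> \<open>Strict positivity lets the logarithm preserve the comparison of purities. At
    \<open>\<eta> = 0\<close> it comes from \<open>1 / d\<^sup>2\<close>, otherwise from
    \<open>\<eta>\<^sup>2\<close>.\<close>
  then have pos: "\<eta>\<^sup>2 + (1 - \<eta>\<^sup>2) / d\<^sup>2 > 0"
    using d by (cases "\<eta> = 0") (auto intro!: add_pos_nonneg)
  have "log 2 (\<eta>\<^sup>2 + (1 - \<eta>\<^sup>2) / d\<^sup>2) \<le> log 2 (1 / d)"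
    using le pos d by simp
  then show ?thesis
    unfolding cond_renyi2_def renyi2_def purity_isotropic purity_partial_trace_isotropic
      Re_complex_of_real
    by (simp only: d_def)
qed

end
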